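(* There exists a polynomial $p$ such that for every $n\in\mathbb{N}$ and every $\varepsilon\in(0,1)$ there exists a (not necessarily explicit) deterministic nonadaptive $\varepsilon$-sampler, with query complexity at most $p(n/\varepsilon)$, for the class of functions $\{0,1\}^n\to\{0,1\}$ computed by permutation branching programs of length $n$ and arbitrary (unbounded) finite width with a single accept state.
   Context: An ordered branching program $B$ of length $n$ and width $w$ has layers $V_0,\dots,V_n$, each a copy of $\{1,\dots,w\}$, a start state $v_0\in V_0$, transition functions $B_r:V_{r-1}\times\{0,1\}\to V_r$ for $r=1,\dots,n$, and a set $V_{\mathit{acc}}\subseteq V_n$ of accept states. On input $\sigma\in\{0,1\}^n$ it sets $v_r=B_r(v_{r-1},\sigma_r)$ and $B(\sigma)=1$ iff $v_n\in V_{\mathit{acc}}$. It is a permutation branching program if for every $r$ and $b\in\{0,1\}$ the map $B_r(\cdot,b)$ is a permutation of $\{1,\dots,w\}$. "Unbounded width" means the width $w$ may be any natural number. For a class $\mathcal{F}$ of functions $\{0,1\}^n\to\{0,1\}$, a deterministic $\varepsilon$-sampler is a deterministic algorithm that, given oracle access to any $f\in\mathcal{F}$, makes queries to $f$ and outputs a real number $\mathrm{Samp}^f()$ with $|\mathrm{Samp}^f()-\Pr_{x\sim U_n}[f(x)=1]|\le\varepsilon$, where $U_n$ is uniform on $\{0,1\}^n$. Its query complexity is the maximum over $f\in\mathcal{F}$ of the number of distinct queries made. It is nonadaptive if its queries do not depend on the answers to previous queries. *)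

theory Defs
  imports "HOL-Probability.Probability" "HOL-Computational_Algebra.Polynomial"
begin

definition cube :: "nat \<Rightarrow> bool list set" where
  "cube n = {x. length x = n}"

text \<open>The states of every layer are \<open>{1..width}\<close>; \<open>transition B r v b\<close> is the transition
  from layer \<open>r - 1\<close> to layer \<open>r\<close>, relevant only for \<open>1 \<le> r \<le> n\<close>. Bit \<open>r\<close> of the input
  \<open>x\<close> is \<open>x ! (r - 1)\<close>.\<close>

record branching_program =
  width :: nat
  start :: nat
  transition :: "nat \<Rightarrow> nat \<Rightarrow> bool \<Rightarrow> nat"
  accept :: "nat set"

definition ordered_bp :: "nat \<Rightarrow> branching_program \<Rightarrow> bool" where
  "ordered_bp n B \<longleftrightarrow>
     start B \<in> {1..width B} \<and>
     (\<forall>r\<in>{1..n}. \<forall>v\<in>{1..width B}. \<forall>b. transition B r v b \<in> {1..width B}) \<and>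
     accept B \<subseteq> {1..width B}"

definition permutation_bp :: "nat \<Rightarrow> branching_program \<Rightarrow> bool" where
  "permutation_bp n B \<longleftrightarrow>
     ordered_bp n B \<and>
     (\<forall>r\<in>{1..n}. \<forall>b. bij_betw (\<lambda>v. transition B r v b) {1..width B} {1..width B})"

primrec state :: "branching_program \<Rightarrow> bool list \<Rightarrow> nat \<Rightarrow> nat" where
  "state B x 0 = start B"
| "state B x (Suc r) = transition B (Suc r) (state B x r) (x ! r)"

definition computes :: "nat \<Rightarrow> branching_program \<Rightarrow> (bool list \<Rightarrow> bool) \<Rightarrow> bool" where
  "computes n B f \<longleftrightarrow> (\<forall>x\<in>cube n. f x \<longleftrightarrow> state B x n \<in> accept B)"

text \<open>Functions \<open>{0,1}\<^sup>n \<rightarrow> {0,1}\<close> are total functions on \<open>bool list\<close> whose values outside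
  \<open>cube n\<close> are unconstrained; samplers may query only points of \<open>cube n\<close>.\<close>

definition perm_bp_single_accept :: "nat \<Rightarrow> (bool list \<Rightarrow> bool) set" where
  "perm_bp_single_accept n =
     {f. \<exists>B. permutation_bp n B \<and> card (accept B) = 1 \<and> computes n B f}"

text \<open>A (nonuniform) deterministic oracle algorithm is a decision tree: it either halts with a
  real output or queries a point and continues according to the answer.\<close>

datatype oracle_alg = Output real | Query "bool list" "bool \<Rightarrow> oracle_alg"

primrec samp :: "oracle_alg \<Rightarrow> (bool list \<Rightarrow> bool) \<Rightarrow> real" where
  "samp (Output a) f = a"
| "samp (Query x k) f = samp (k (f x)) f"

primrec queries :: "oracle_alg \<Rightarrow> (bool list \<Rightarrow> bool) \<Rightarrow> bool list list" where
  "queries (Output a) f = []"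
| "queries (Query x k) f = x # queries (k (f x)) f"

definition deterministic_sampler ::
    "nat \<Rightarrow> (bool list \<Rightarrow> bool) set \<Rightarrow> real \<Rightarrow> oracle_alg \<Rightarrow> bool" where
  "deterministic_sampler n F \<epsilon> S \<longleftrightarrow>
     (\<forall>f\<in>F. set (queries S f) \<subseteq> cube n \<and>
       \<bar>samp S f - measure_pmf.prob (pmf_of_set (cube n)) {x. f x}\<bar> \<le> \<epsilon>)"

definition nonadaptive :: "oracle_alg \<Rightarrow> bool" where
  "nonadaptive S \<longleftrightarrow> (\<forall>f g. queries S f = queries S g)"

text \<open>The supremum is a maximum: the tree has finite depth, so the counts are bounded.\<close>

definition query_complexity :: "(bool list \<Rightarrow> bool) set \<Rightarrow> oracle_alg \<Rightarrow> nat" where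
  "query_complexity F S = (SUP f\<in>F. card (set (queries S f)))"

lemma finite_query_counts: "finite ((\<lambda>f. card (set (queries S f))) ` F)"
proof -
  have "\<exists>d. \<forall>f. length (queries S f) \<le> d"
  proof (induction S)
    case (Output a)
    show ?case by simp
  next
    case (Query x k)
    then have "\<exists>d. \<forall>f. length (queries (k b) f) \<le> d" for b
      by blast
    then obtain d where "\<And>b f. length (queries (k b) f) \<le> d b"
      by metis
    then have "length (queries (Query x k) f) \<le> Suc (max (d True) (d False))" for f
      by (cases "f x") (simp_all add: le_max_iff_disj)
    then show ?case by blast
  qed
  then obtain d where "\<And>f. length (queries S f) \<le> d" by blast
  then have "(\<lambda>f. card (set (queries S f))) ` F \<subseteq> {..d}"
    using card_length le_trans by fastforce
  then show ?thesis using finite_subset by blast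
qed

end

theory Submission
  imports Defs
begin

text \<open>
  Let \<open>p v\<close> be the probability of reaching a state \<open>v\<close> from the start and \<open>q v\<close> that of
  reaching the accept state from \<open>v\<close>. Up to density \<open>2 * \<delta>\<close>, accepted inputs only visit states
  with \<open>p v \<ge> \<delta>\<close> and \<open>q v \<ge> \<delta>\<close>. A layer of a permutation program has at most \<open>1 / \<delta>\<close>
  states of either kind, so after discarding the others the program is narrow; narrow programs
  are few, and hence polynomially many prefixes \<open>Y r\<close> and suffixes \<open>Z r\<close> hit all heavy states of
  layer \<open>r\<close>, for all programs at once. Query all \<open>y @ z\<close> and \<open>y @ b # z'\<close> with \<open>y\<close> in
  \<open>Y r\<close>, \<open>z\<close> in \<open>Z r\<close> and \<open>z'\<close> in \<open>Z (Suc r)\<close>. In a permutation program two prefixes with a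
  common accepted suffix end in the same state, so the answers reveal all transitions between
  heavy states. Therefore programs with the same answers have acceptance probabilities that
  differ by at most \<open>2 * \<delta>\<close>, and the sampler may output that of any consistent program.
\<close>

section \<open>Runs of injective programs\<close>

text \<open>Transitions are indexed by the number of bits that remain to be read, so that
  suffix sets of a program and prefix sets of its reversal are treated alike.\<close>

primrec run :: "(nat \<Rightarrow> bool \<Rightarrow> 'v \<Rightarrow> 'v) \<Rightarrow> bool list \<Rightarrow> 'v \<Rightarrow> 'v" where
  "run g [] u = u"
| "run g (b # x) u = run g x (g (length x) b u)"

text \<open>The accepted continuations of \<open>u\<close> when \<open>s\<close> is the accept state
  and \<open>k\<close> bits remain. For the reversed program, with \<open>s\<close> the start, these
  are the reversed prefixes that lead to \<open>u\<close>.\<close>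

definition reach :: "(nat \<Rightarrow> bool \<Rightarrow> 'v \<Rightarrow> 'v) \<Rightarrow> 'v \<Rightarrow> nat \<Rightarrow> 'v \<Rightarrow> bool list set" where
  "reach g s k u = {x \<in> cube k. run g x u = s}"

section \<open>Counting in cubes and \<open>reach\<close> sets\<close>

lemma finite_cube [simp]: "finite (cube n)"
  using finite_lists_length_eq[of "UNIV :: bool set" n] by (simp add: cube_def)

lemma card_cube [simp]: "card (cube n) = 2 ^ n"
  using card_lists_length_eq[of "UNIV :: bool set" n] by (simp add: cube_def)

lemma cube_nonempty [simp]: "cube n \<noteq> {}"
  using card_cube[of n] by (metis card.empty power_not_zero zero_neq_numeral)

lemma cube_0 [simp]: "cube 0 = {[]}"
  by (auto simp: cube_def)

lemma inj_run:
  assumes "\<And>k b. inj (g k b)"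
  shows "inj (run g x)"
proof (induction x)
  case (Cons b x)
  have "run g (b # x) = run g x \<circ> g (length x) b" by auto
  then show ?case using Cons assms by (metis inj_compose)
qed (simp add: inj_def)

lemma finite_reach [simp]: "finite (reach g s k u)"
  by (simp add: reach_def)

lemma card_Cons_Un:
  assumes "finite A" "finite B"
  shows "card (Cons True ` A \<union> Cons False ` B) = card A + card B"
proof -
  have "card (Cons True ` A \<union> Cons False ` B) = card (Cons True ` A) + card (Cons False ` B)"
    using assms by (intro card_Un_disjoint) auto
  then show ?thesis by (simp add: card_image)
qed

lemma reach_0: "reach g s 0 u = (if u = s then {[]} else {})"
  by (auto simp: reach_def)

lemma reach_Suc:
  "reach g s (Suc k) u =
     Cons True ` reach g s k (g k True u) \<union> Cons False ` reach g s k (g k False u)"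
  (is "?L = ?R")
proof (rule set_eqI)
  fix x
  show "x \<in> ?L \<longleftrightarrow> x \<in> ?R"
  proof (cases x)
    case (Cons b y)
    then show ?thesis by (cases b) (auto simp: reach_def cube_def)
  qed (auto simp: reach_def cube_def)
qed

lemma card_reach_Suc:
  "card (reach g s (Suc k) u) =
     card (reach g s k (g k True u)) + card (reach g s k (g k False u))"
  by (simp add: reach_Suc card_Cons_Un)

lemma disjoint_reach:
  assumes "\<And>k b. inj (g k b)" "u \<noteq> v"
  shows "reach g s k u \<inter> reach g s k v = {}"
  using inj_run[of g, OF assms(1)] assms(2) by (fastforce simp: reach_def inj_def)

text \<open>By injectivity, different states have disjoint \<open>reach\<close> sets, and at most
  \<open>1 / \<theta>\<close> disjoint sets of density \<open>\<theta>\<close> fit into one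
  cube.\<close>

lemma card_heavy_le:
  fixes g :: "nat \<Rightarrow> bool \<Rightarrow> 'v \<Rightarrow> 'v" and s :: 'v and k :: nat
  assumes inj: "\<And>k b. inj (g k b)" and "0 < \<theta>"
  defines "H \<equiv> {u. \<theta> * 2 ^ k \<le> real (card (reach g s k u))}"
  shows "finite H" "real (card H) \<le> 1 / \<theta>"
proof -
  \<comment> \<open>Finite subsets come first: the state type may be infinite, and
    \<open>card\<close> is 0 on infinite sets.\<close>
  have bound: "real (card K) \<le> 1 / \<theta>" if "finite K" "K \<subseteq> H" for K
  proof -
    have "real (card K) * (\<theta> * 2 ^ k) \<le> (\<Sum>u\<in>K. real (card (reach g s k u)))"
      using that by (intro sum_bounded_below) (auto simp: H_def)
    also have "\<dots> = real (card (\<Union>u\<in>K. reach g s k u))"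
      using that disjoint_reach[of g, OF inj] by (subst card_UN_disjoint) auto
    also have "\<dots> \<le> real (card (cube k))"
      by (intro of_nat_mono card_mono) (auto simp: reach_def)
    finally have "real (card K) * \<theta> * 2 ^ k \<le> 1 * 2 ^ k" by (simp add: mult.assoc)
    then have "real (card K) * \<theta> \<le> 1" by (simp only: mult_le_cancel_right) simp
    then show ?thesis using \<open>0 < \<theta>\<close> by (simp add: field_simps)
  qed
  show "finite H"
  proof (rule ccontr)
    assume "infinite H"
    then obtain K where K: "finite K" "card K = Suc (nat \<lceil>1 / \<theta>\<rceil>)" "K \<subseteq> H"
      using infinite_arbitrarily_large by blast
    then show False using bound[of K] by linarith
  qed
  then show "real (card H) \<le> 1 / \<theta>" using bound by blast
qed

text \<open>Averaging over the two successors keeps the bound \<open>\<delta>\<close>, so there is no loss in the length.\<close>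

lemma card_light_paths_le:
  assumes inj: "\<And>k b. inj (g k b)" and "0 \<le> \<delta>"
  shows "real (card {x \<in> reach g s k u.
     \<exists>y z v. x = y @ z \<and> run g z v = s \<and>
       real (card (reach g s (length z) v)) < \<delta> * 2 ^ length z}) \<le> \<delta> * 2 ^ k"
    (is "real (card (?L k u)) \<le> _")
proof (induction k arbitrary: u)
  case 0
  show ?case
  proof (cases "real (card (reach g s 0 u)) < \<delta> * 2 ^ 0")
    case True
    have "card (?L 0 u) \<le> card (reach g s 0 u)" by (intro card_mono) auto
    then show ?thesis using True by simp
  next
    case False
    have "?L 0 u = {}" using False by (auto simp: reach_def)
    then show ?thesis using \<open>0 \<le> \<delta>\<close> by (simp only: card.empty) simp
  qed
next
  case (Suc k)
  show ?case
  proof (cases "real (card (reach g s (Suc k) u)) < \<delta> * 2 ^ Suc k")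
    case True
    have "card (?L (Suc k) u) \<le> card (reach g s (Suc k) u)" by (intro card_mono) auto
    then show ?thesis using True by linarith
  next
    case False
    have "?L (Suc k) u \<subseteq> Cons True ` ?L k (g k True u) \<union> Cons False ` ?L k (g k False u)"
    proof
      fix x assume "x \<in> ?L (Suc k) u"
      then obtain y z v where x: "x \<in> reach g s (Suc k) u" "x = y @ z" "run g z v = s"
        "real (card (reach g s (length z) v)) < \<delta> * 2 ^ length z" by blast
      show "x \<in> Cons True ` ?L k (g k True u) \<union> Cons False ` ?L k (g k False u)"
      proof (cases y)
        case Nil
        then have "run g x u = run g x v" "length z = Suc k"
          using x by (auto simp: reach_def cube_def)
        \<comment> \<open>The light state \<open>v\<close> is specified only by leading to
          \<open>s\<close> along \<open>z\<close>. Injectivity makes it the visited state, here the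
          heavy \<open>u\<close>.\<close>
        then have "u = v" using injD[OF inj_run[of g, OF inj]] by blast
        then show ?thesis using x(4) \<open>length z = Suc k\<close> False by simp
      next
        case (Cons b y')
        then have "y' @ z \<in> ?L k (g k b u)" using x by (auto simp: reach_def cube_def)
        then show ?thesis using x(2) Cons by (cases b) auto
      qed
    qed
    then have "card (?L (Suc k) u) \<le>
        card (Cons True ` ?L k (g k True u) \<union> Cons False ` ?L k (g k False u))"
      by (intro card_mono) auto
    then have "card (?L (Suc k) u) \<le> card (?L k (g k True u)) + card (?L k (g k False u))"
      by (subst (asm) card_Cons_Un) auto
    then show ?thesis using Suc[of "g k True u"] Suc[of "g k False u"] by simp
  qed
qed

section \<open>Hitting sets\<close>

text \<open>Greedy choice: the sets not yet hit have average density at least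
  \<open>\<theta>\<close>, so some point lies in a fraction \<open>\<theta>\<close> of them. Adding
  it leaves at most a fraction \<open>1 - \<theta>\<close>.\<close>

lemma greedy_hitting_set:
  fixes C :: "'a set set"
  assumes "finite X" "X \<noteq> {}" "finite C" "\<theta> \<le> 1"
    and C: "\<And>S. S \<in> C \<Longrightarrow> S \<subseteq> X \<and> \<theta> * real (card X) \<le> real (card S)"
  shows "\<exists>H\<subseteq>X. card H \<le> m \<and> real (card {S \<in> C. S \<inter> H = {}}) \<le> real (card C) * (1 - \<theta>) ^ m"
proof (induction m)
  case 0
  show ?case by (intro exI[of _ "{}"]) simp
next
  case (Suc m)
  then obtain H where H: "H \<subseteq> X" "card H \<le> m"
    "real (card {S \<in> C. S \<inter> H = {}}) \<le> real (card C) * (1 - \<theta>) ^ m" by blast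
  define U where "U = {S \<in> C. S \<inter> H = {}}"
  have "finite U" using \<open>finite C\<close> by (simp add: U_def)
  have finH: "finite H" using H \<open>finite X\<close> finite_subset by blast
  \<comment> \<open>Otherwise counting the incidences \<open>x \<in> S\<close> by points and by sets
    gives contradictory bounds.\<close>
  have "\<exists>x\<in>X. \<theta> * real (card U) \<le> real (card {S \<in> U. x \<in> S})"
  proof (rule ccontr)
    assume "\<not> ?thesis"
    then have "(\<Sum>x\<in>X. real (card {S \<in> U. x \<in> S})) < (\<Sum>x\<in>X. \<theta> * real (card U))"
      using \<open>X \<noteq> {}\<close> \<open>finite X\<close> by (intro sum_strict_mono) (auto simp: not_le)
    also have "\<dots> = (\<Sum>S\<in>U. \<theta> * real (card X))" by simp
    also have "\<dots> \<le> (\<Sum>S\<in>U. real (card S))"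
      using C by (intro sum_mono) (auto simp: U_def)
    also have "\<dots> = (\<Sum>S\<in>U. \<Sum>x\<in>X. if x \<in> S then 1 else 0)"
      using C \<open>finite X\<close> by (intro sum.cong) (auto simp: U_def sum.If_cases Int_absorb1)
    also have "\<dots> = (\<Sum>x\<in>X. \<Sum>S\<in>U. if x \<in> S then 1 else 0)" by (rule sum.swap)
    also have "\<dots> = (\<Sum>x\<in>X. real (card {S \<in> U. x \<in> S}))"
      using \<open>finite U\<close> by (intro sum.cong) (auto simp: sum.If_cases Int_def)
    finally show False by simp
  qed
  then obtain x where x: "x \<in> X" "\<theta> * real (card U) \<le> real (card {S \<in> U. x \<in> S})" by blast
  have "{S \<in> C. S \<inter> insert x H = {}} = U - {S \<in> U. x \<in> S}" by (auto simp: U_def)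
  then have "real (card {S \<in> C. S \<inter> insert x H = {}}) =
      real (card U) - real (card {S \<in> U. x \<in> S})"
    using \<open>finite U\<close> by (simp add: card_Diff_subset card_mono of_nat_diff)
  also have "\<dots> \<le> real (card U) * (1 - \<theta>)" using x by (simp add: algebra_simps)
  also have "\<dots> \<le> (real (card C) * (1 - \<theta>) ^ m) * (1 - \<theta>)"
    using H \<open>\<theta> \<le> 1\<close> by (intro mult_right_mono) (auto simp: U_def)
  finally have "real (card {S \<in> C. S \<inter> insert x H = {}}) \<le> real (card C) * (1 - \<theta>) ^ Suc m"
    by (simp add: mult_ac)
  moreover have "card (insert x H) \<le> Suc m" using H finH by (simp add: card_insert_if)
  ultimately show ?case using x H by (intro exI[of _ "insert x H"]) blast
qed

text \<open>Families of sets recognised by the states of a program with at most \<open>w\<close> states per layer;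
  index \<open>w\<close> is a rejecting sink.\<close>

primrec narrow :: "nat \<Rightarrow> nat \<Rightarrow> (nat \<Rightarrow> bool list set) set" where
  "narrow w 0 = {\<lambda>i. if i = 0 then {[]} else {}}"
| "narrow w (Suc k) =
     (\<lambda>(F, c) i. if i < w then Cons True ` F (c (True, i)) \<union> Cons False ` F (c (False, i)) else {}) `
       (narrow w k \<times> PiE (UNIV \<times> {..<w}) (\<lambda>_. {..w}))"

text \<open>A layer has \<open>2 * w\<close> transitions, each with \<open>w + 1\<close> possible
  targets, the sink included.\<close>

lemma narrow_finite_card: "finite (narrow w k) \<and> card (narrow w k) \<le> (w + 1) ^ (2 * w * k)"
proof (induction k)
  case (Suc k)
  let ?P = "PiE (UNIV \<times> {..<w}) (\<lambda>_. {..w}) :: (bool \<times> nat \<Rightarrow> nat) set"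
  have fin: "finite ?P" by (intro finite_PiE) auto
  have "card ?P = (w + 1) ^ (2 * w)"
    by (subst card_PiE) (auto simp: card_cartesian_product)
  then have "card (narrow w k \<times> ?P) \<le> (w + 1) ^ (2 * w * k) * (w + 1) ^ (2 * w)"
    using Suc by (simp add: card_cartesian_product)
  moreover have "card (narrow w (Suc k)) \<le> card (narrow w k \<times> ?P)"
    unfolding narrow.simps using Suc fin by (intro card_image_le) auto
  ultimately show ?case using Suc fin by (auto simp: power_add mult.commute)
qed simp

lemma narrow_subset_cube: "F \<in> narrow w k \<Longrightarrow> F i \<subseteq> cube k"
proof (induction k arbitrary: F i)
  case (Suc k)
  then obtain F' c where "F' \<in> narrow w k"
    and F: "F = (\<lambda>i. if i < w then Cons True ` F' (c (True, i)) \<union> Cons False ` F' (c (False, i)) else {})"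
    by auto
  then have "length x = k" if "x \<in> F' j" for x j using Suc.IH that by (auto simp: cube_def)
  then show ?case by (auto simp: F cube_def)
qed (auto split: if_splits)

lemma narrow_sink: "F \<in> narrow w k \<Longrightarrow> 0 < w \<Longrightarrow> F w = {}"
  by (cases k) auto

text \<open>Dropping the states of density below \<open>\<theta>\<close> loses at most density \<open>\<theta>\<close>, again by averaging.\<close>

lemma narrow_approximation:
  assumes inj: "\<And>k b. inj (g k b)" and "0 < \<theta>" "\<theta> \<le> 1" "1 / \<theta> \<le> real w"
  shows "\<exists>F\<in>narrow w k. \<exists>e. \<forall>u. \<theta> * 2 ^ k \<le> real (card (reach g s k u)) \<longrightarrow>
    e u < w \<and> F (e u) \<subseteq> reach g s k u \<and>
    real (card (reach g s k u)) - \<theta> * 2 ^ k \<le> real (card (F (e u)))"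
proof (induction k)
  case 0
  have "w > 0" using assms by (cases w) auto
  \<comment> \<open>With no bits left only \<open>s\<close> is heavy, as
    \<open>\<theta> > 0\<close>; it gets index 0.\<close>
  then show ?case
    using assms by (intro bexI[of _ "\<lambda>i. if i = 0 then {[]} else {}"] exI[of _ "\<lambda>_. 0"])
      (auto simp: reach_0)
next
  case (Suc k)
  let ?h = "\<lambda>k u. \<theta> * 2 ^ k \<le> real (card (reach g s k u))"
  have "w > 0" using assms by (cases w) auto
  obtain F e where F: "F \<in> narrow w k" and e: "\<And>u. ?h k u \<Longrightarrow>
    e u < w \<and> F (e u) \<subseteq> reach g s k u \<and>
    real (card (reach g s k u)) - \<theta> * 2 ^ k \<le> real (card (F (e u)))"
    using Suc by blast
  have finF: "finite (F i)" for i
    using narrow_subset_cube[OF F] finite_subset finite_cube by blast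
  \<comment> \<open>There are at most \<open>1 / \<theta> \<le> w\<close> heavy states in this
    layer, so distinct indices below \<open>w\<close> can name them.\<close>
  define H where "H = {u. ?h (Suc k) u}"
  have "finite H" "real (card H) \<le> 1 / \<theta>"
    unfolding H_def by (rule card_heavy_le[of g, OF inj \<open>0 < \<theta>\<close>])+
  then have "card H \<le> card {..<w}" using assms by simp
  then obtain d where d: "d ` H \<subseteq> {..<w}" "inj_on d H"
    using card_le_inj[OF \<open>finite H\<close>, of "{..<w}"] by blast
  \<comment> \<open>Light successors are sent to the sink \<open>w\<close>, as are indices that name
    no heavy state.\<close>
  define c where "c = restrict (\<lambda>(b, i). if i \<in> d ` H \<and> ?h k (g k b (inv_into H d i))
    then e (g k b (inv_into H d i)) else w) (UNIV \<times> {..<w})"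
  have c: "c \<in> PiE (UNIV \<times> {..<w}) (\<lambda>_. {..w})"
    using less_imp_le[OF conjunct1[OF e]] by (auto simp: c_def)
  define F' where "F' = (\<lambda>i. if i < w then Cons True ` F (c (True, i)) \<union> Cons False ` F (c (False, i)) else {})"
  have F': "F' \<in> narrow w (Suc k)"
    unfolding narrow.simps F'_def using F c by (intro image_eqI[of _ _ "(F, c)"]) auto
  have "d u < w \<and> F' (d u) \<subseteq> reach g s (Suc k) u \<and>
    real (card (reach g s (Suc k) u)) - \<theta> * 2 ^ Suc k \<le> real (card (F' (d u)))"
    if "?h (Suc k) u" for u
  proof -
    have u: "u \<in> H" using that by (simp add: H_def)
    then have dw: "d u < w" using d by auto
    have cu: "c (b, d u) = (if ?h k (g k b u) then e (g k b u) else w)" for b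
      using u d dw by (simp add: c_def)
    have sub: "F (c (b, d u)) \<subseteq> reach g s k (g k b u)" for b
      using e narrow_sink[OF F \<open>w > 0\<close>] by (simp add: cu)
    \<comment> \<open>A light successor loses less than \<open>\<theta> * 2 ^ k\<close> in the sink,
      a heavy one at most that by induction. The two losses add up to
      \<open>\<theta> * 2 ^ Suc k\<close>.\<close>
    have card: "real (card (reach g s k (g k b u))) - \<theta> * 2 ^ k \<le> real (card (F (c (b, d u))))" for b
      using e narrow_sink[OF F \<open>w > 0\<close>] by (simp add: cu)
    have "F' (d u) \<subseteq> reach g s (Suc k) u"
      using sub[of True] sub[of False] dw by (auto simp: F'_def reach_Suc)
    moreover have "card (F' (d u)) = card (F (c (True, d u))) + card (F (c (False, d u)))"
      using dw finF by (simp add: F'_def card_Cons_Un)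
    ultimately show ?thesis
      using card[of True] card[of False] dw by (simp add: card_reach_Suc)
  qed
  then show ?case using F' by blast
qed

text \<open>\<open>H\<close> is chosen before the program: it hits every set of density at least
  \<open>\<theta>\<close> recognised by a narrow program, and a \<open>reach\<close> set of density
  \<open>2 * \<theta>\<close> contains such a set. The logarithm of the number of these sets is
  polynomial in \<open>k\<close> and \<open>1 / \<theta>\<close>, so few points suffice.\<close>

lemma hitting_set:
  fixes \<theta> :: real
  assumes "0 < \<theta>" "\<theta> \<le> 1"
  shows "\<exists>H\<subseteq>cube k. real (card H) \<le> 10 * (real k + 1) / \<theta> ^ 3 \<and>
    (\<forall>(g :: nat \<Rightarrow> bool \<Rightarrow> 'v \<Rightarrow> 'v) s u. (\<forall>k b. inj (g k b)) \<longrightarrow>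
       2 * \<theta> * 2 ^ k \<le> real (card (reach g s k u)) \<longrightarrow> reach g s k u \<inter> H \<noteq> {})"
proof -
  define w where "w = nat \<lceil>1 / \<theta>\<rceil>"
  have \<theta>1: "1 \<le> 1 / \<theta>" using assms by simp
  have w: "1 / \<theta> \<le> real w" "real w \<le> 2 / \<theta>" "1 \<le> real w"
    using \<theta>1 unfolding w_def by linarith+
  define C where "C = {S \<in> (\<lambda>(F, i). F i) ` (narrow w k \<times> {..<w}). \<theta> * 2 ^ k \<le> real (card S)}"
  have fin: "finite (narrow w k \<times> {..<w})" using narrow_finite_card by blast
  then have "finite C" by (simp add: C_def)
  have "card C \<le> card ((\<lambda>(F, i). F i) ` (narrow w k \<times> {..<w}))"
    using fin by (intro card_mono) (auto simp: C_def)
  also have "\<dots> \<le> card (narrow w k \<times> {..<w})" by (rule card_image_le[OF fin])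
  also have "\<dots> = card (narrow w k) * w" by (simp add: card_cartesian_product)
  also have "\<dots> \<le> (w + 1) ^ (2 * w * k) * (w + 1)"
    using narrow_finite_card by (intro mult_mono) auto
  finally have "card C \<le> (w + 1) ^ (2 * w * k + 1)" by (simp add: mult.commute)
  then have "real (card C) \<le> real (w + 1) ^ (2 * w * k + 1)"
    by (metis of_nat_le_iff of_nat_power)
  also have "\<dots> \<le> exp (real w) ^ (2 * w * k + 1)"
    using exp_ge_add_one_self[of "real w"] by (intro power_mono) auto
  also have "\<dots> = exp (real w * real (2 * w * k + 1))" by (simp only: exp_of_nat2_mult)
  finally have cardC: "real (card C) \<le> exp (real w * real (2 * w * k + 1))" .
  \<comment> \<open>Large enough that \<open>card C * exp (- \<theta> * m) < 1\<close>; then fewer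
    than one set is missed, hence none.\<close>
  define m where "m = nat \<lfloor>real w * real (2 * w * k + 1) / \<theta>\<rfloor> + 1"
  have m: "real w * real (2 * w * k + 1) / \<theta> < real m"
    and m': "real m \<le> real w * real (2 * w * k + 1) / \<theta> + 1"
    using assms by (auto simp: m_def) linarith+
  have "S \<subseteq> cube k \<and> \<theta> * real (card (cube k)) \<le> real (card S)" if "S \<in> C" for S
    using that by (auto simp: C_def dest: narrow_subset_cube[THEN subsetD])
  from greedy_hitting_set[OF finite_cube cube_nonempty \<open>finite C\<close> \<open>\<theta> \<le> 1\<close> this, of m]
  obtain H where H: "H \<subseteq> cube k" "card H \<le> m"
    "real (card {S \<in> C. S \<inter> H = {}}) \<le> real (card C) * (1 - \<theta>) ^ m" by blast
  have "(1 - \<theta>) ^ m \<le> exp (- \<theta>) ^ m"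
    using assms exp_ge_add_one_self[of "- \<theta>"] by (intro power_mono) auto
  also have "\<dots> = exp (- (\<theta> * real m))" by (simp add: exp_of_nat_mult[symmetric] mult.commute)
  finally have "real (card C) * (1 - \<theta>) ^ m \<le> exp (real w * real (2 * w * k + 1)) * exp (- (\<theta> * real m))"
    using cardC assms by (intro mult_mono) auto
  also have "\<dots> = exp (real w * real (2 * w * k + 1) - \<theta> * real m)" by (simp add: exp_diff exp_minus field_simps)
  also have "\<dots> < 1" using m assms by (simp add: field_simps)
  finally have "real (card {S \<in> C. S \<inter> H = {}}) < 1" using H by linarith
  then have "{S \<in> C. S \<inter> H = {}} = {}" using \<open>finite C\<close> by simp
  then have hit: "S \<inter> H \<noteq> {}" if "S \<in> C" for S using that by blast
  have "reach g s k u \<inter> H \<noteq> {}"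
    if g: "\<forall>k b. inj (g k b)" and big: "2 * \<theta> * 2 ^ k \<le> real (card (reach g s k u))"
    for g :: "nat \<Rightarrow> bool \<Rightarrow> 'v \<Rightarrow> 'v" and s u
  proof -
    have "0 \<le> \<theta> * 2 ^ k" using assms by simp
    with big have h: "\<theta> * 2 ^ k \<le> real (card (reach g s k u))" by linarith
    obtain F i where F: "F \<in> narrow w k" "i < w" "F i \<subseteq> reach g s k u"
      "real (card (reach g s k u)) - \<theta> * 2 ^ k \<le> real (card (F i))"
      using narrow_approximation[of g, OF _ assms w(1)] g h by blast
    then have "F i \<in> C" using big by (force simp: C_def)
    then show ?thesis using hit F by blast
  qed
  moreover have "real (card H) \<le> 10 * (real k + 1) / \<theta> ^ 3"
  proof -
    \<comment> \<open>As \<open>t \<ge> 1\<close>, the lower powers of \<open>t\<close> are absorbed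
      into \<open>t ^ 3\<close>.\<close>
    define t where "t = 1 / \<theta>"
    have t: "1 \<le> t" "real w \<le> 2 * t" using \<theta>1 w by (auto simp: t_def)
    have wk: "real (2 * w * k + 1) \<le> 2 * (2 * t) * k + 1"
      using mult_right_mono[OF t(2), of "real k"] by (simp add: mult_ac)
    have "real (card H) \<le> real w * real (2 * w * k + 1) * t + 1" using m' H by (simp add: t_def)
    also have "\<dots> \<le> (2 * t) * (2 * (2 * t) * k + 1) * t + 1"
      using t wk by (intro add_right_mono mult_right_mono mult_mono) auto
    also have "\<dots> = 8 * k * t ^ 3 + 2 * t ^ 2 + 1" by (simp add: algebra_simps power_numeral_reduce)
    also have "\<dots> \<le> 8 * k * t ^ 3 + 2 * t ^ 3 + t ^ 3"
      using t power_increasing[of 2 3 t] one_le_power[of t 3] by linarith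
    also have "\<dots> = (8 * real k + 3) * t ^ 3" by (simp add: algebra_simps)
    also have "\<dots> \<le> 10 * (real k + 1) * t ^ 3" using t by (intro mult_right_mono) auto
    finally show ?thesis by (simp add: t_def power_divide)
  qed
  ultimately show ?thesis using H by blast
qed

section \<open>Queries that determine the acceptance probability\<close>

text \<open>Indexed by the number of bits already read, as the layers of a branching program are;
  \<open>walk_eq_run\<close> passes to the indexing of \<open>run\<close>.\<close>

primrec walk :: "(nat \<Rightarrow> bool \<Rightarrow> 'v \<Rightarrow> 'v) \<Rightarrow> nat \<Rightarrow> bool list \<Rightarrow> 'v \<Rightarrow> 'v" where
  "walk T i [] v = v"
| "walk T i (b # x) v = walk T (Suc i) x (T i b v)"

section \<open>Walks and their reversals\<close>

lemma walk_append: "walk T i (x @ y) v = walk T (i + length x) y (walk T i x v)"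
  by (induction x arbitrary: i v) auto

lemma walk_eq_run: "i + length x = n \<Longrightarrow> walk T i x v = run (\<lambda>k. T (n - Suc k)) x v"
proof (induction x arbitrary: i v)
  case (Cons b x)
  have "n - Suc (length x) = i" using Cons.prems by auto
  then show ?case using Cons by simp
qed simp

lemma inj_walk:
  assumes "\<And>i b. inj (T i b)"
  shows "inj (walk T i x)"
proof -
  have "walk T i x = run (\<lambda>k. T (i + length x - Suc k)) x"
    by (rule ext) (rule walk_eq_run[OF refl])
  then show ?thesis using inj_run[of "\<lambda>k. T (i + length x - Suc k)" x] assms by simp
qed

text \<open>Reading backwards with inverse permutations undoes a walk. The bit at position
  \<open>i\<close> has \<open>i\<close> bits after it in the reversed word, so the inverse of
  \<open>T i\<close> keeps its index under \<open>run\<close>. Prefix sets thus become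
  \<open>reach\<close> sets.\<close>

lemma run_inv_rev_iff:
  assumes "\<And>i b. bij (T i b)"
  shows "run (\<lambda>k b. inv (T k b)) (rev x) u = s \<longleftrightarrow> walk T 0 x s = u"
proof (induction x arbitrary: u rule: rev_induct)
  case (snoc b x)
  have "walk T 0 x s = inv (T (length x) b) u \<longleftrightarrow> T (length x) b (walk T 0 x s) = u"
    using assms by (metis bij_inv_eq_iff)
  then show ?case using snoc by (simp add: walk_append)
qed auto

text \<open>The same sets \<open>H\<close> serve both ends: directly as suffixes, and after
  \<open>rev\<close> as prefixes, since prefixes are hit in the reversed program.\<close>

definition query_set :: "(nat \<Rightarrow> bool list set) \<Rightarrow> nat \<Rightarrow> bool list set" where
  "query_set H n =
     (\<Union>r\<in>{..n}. (\<lambda>(y, z). rev y @ z) ` (H r \<times> H (n - r))) \<union>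
     (\<Union>r\<in>{..<n}. (\<lambda>(y, b, z). rev y @ b # z) ` (H r \<times> UNIV \<times> H (n - Suc r)))"

lemma query_set_subset_cube:
  assumes "\<And>k. H k \<subseteq> cube k"
  shows "query_set H n \<subseteq> cube n"
proof -
  have "length y = k" if "y \<in> H k" for y k using assms that by (auto simp: cube_def)
  then show ?thesis by (auto simp: query_set_def cube_def)
qed

lemma card_query_set_le:
  assumes fin: "\<And>k. finite (H k)" and M: "\<And>k. k \<le> n \<Longrightarrow> card (H k) \<le> M"
  shows "card (query_set H n) \<le> (3 * n + 1) * M ^ 2"
proof -
  have "card (query_set H n) \<le> card (\<Union>r\<in>{..n}. (\<lambda>(y, z). rev y @ z) ` (H r \<times> H (n - r)))
     + card (\<Union>r\<in>{..<n}. (\<lambda>(y, b, z). rev y @ b # z) ` (H r \<times> (UNIV :: bool set) \<times> H (n - Suc r)))"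
    unfolding query_set_def by (rule card_Un_le)
  also have "\<dots> \<le> (\<Sum>r\<in>{..n}. M ^ 2) + (\<Sum>r\<in>{..<n}. 2 * M ^ 2)"
  proof (intro add_mono order.trans[OF card_UN_le] sum_mono)
    fix r assume "r \<in> {..n}"
    have "card ((\<lambda>(y, z). rev y @ z) ` (H r \<times> H (n - r))) \<le> card (H r \<times> H (n - r))"
      using fin by (intro card_image_le) auto
    also have "\<dots> \<le> M * M"
      unfolding card_cartesian_product using M \<open>r \<in> {..n}\<close> by (intro mult_mono) auto
    finally show "card ((\<lambda>(y, z). rev y @ z) ` (H r \<times> H (n - r))) \<le> M ^ 2"
      by (simp add: power2_eq_square)
  next
    fix r assume "r \<in> {..<n}"
    have "card ((\<lambda>(y, b, z). rev y @ b # z) ` (H r \<times> (UNIV :: bool set) \<times> H (n - Suc r)))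
        \<le> card (H r \<times> (UNIV :: bool set) \<times> H (n - Suc r))"
      using fin by (intro card_image_le) auto
    also have "\<dots> \<le> M * (2 * M)"
      unfolding card_cartesian_product using M \<open>r \<in> {..<n}\<close> by (intro mult_mono) auto
    finally show "card ((\<lambda>(y, b, z). rev y @ b # z) ` (H r \<times> (UNIV :: bool set) \<times> H (n - Suc r)))
        \<le> 2 * M ^ 2"
      by (simp add: power2_eq_square)
  qed auto
  also have "\<dots> = (3 * n + 1) * M ^ 2" by (simp add: algebra_simps)
  finally show ?thesis .
qed

text \<open>If two prefixes followed by the same suffix are both accepted, injectivity forces them to
  end in the same state. Hence the witnesses \<open>y r\<close> and \<open>z r\<close> for the states on an
  accepted path force any program with the same answers to follow these witnesses.\<close>

lemma accepts_of_witnesses: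
  assumes inj: "\<And>i b. inj (T' i b)" and "length x = n"
    and y: "\<And>r. r \<le> n \<Longrightarrow> length (y r) = r \<and> walk T 0 (y r) s = walk T 0 (take r x) s"
    and z: "\<And>r. r \<le> n \<Longrightarrow> length (z r) = n - r \<and> walk T r (z r) (walk T 0 (take r x) s) = a"
    and eq1: "\<And>r. r \<le> n \<Longrightarrow>
      walk T 0 (y r @ z r) s = a \<longleftrightarrow> walk T' 0 (y r @ z r) s' = a'"
    and eq2: "\<And>r b. r < n \<Longrightarrow>
      walk T 0 (y r @ b # z (Suc r)) s = a \<longleftrightarrow> walk T' 0 (y r @ b # z (Suc r)) s' = a'"
  shows "walk T' 0 x s' = a'"
proof -
  \<comment> \<open>Layer by layer, \<open>T'\<close> cannot tell a prefix of \<open>x\<close> from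
    its witness.\<close>
  have "walk T' 0 (take r x) s' = walk T' 0 (y r) s'" if "r \<le> n" for r
    using that
  proof (induction r)
    case 0
    then show ?case using y[of 0] by simp
  next
    case (Suc r)
    let ?b = "x ! r"
    have take: "take (Suc r) x = take r x @ [?b]"
      using Suc.prems \<open>length x = n\<close> by (simp add: take_Suc_conv_app_nth)
    have len: "length (take r x) = r" "length (y r) = r" "length (y (Suc r)) = Suc r"
      using Suc.prems \<open>length x = n\<close> y by auto
    have "walk T 0 (y (Suc r) @ z (Suc r)) s = a"
      using y[OF Suc.prems] z[OF Suc.prems] by (simp add: walk_append)
    then have 1: "walk T' 0 (y (Suc r) @ z (Suc r)) s' = a'" using eq1 Suc.prems by blast
    have "walk T 0 (y r @ ?b # z (Suc r)) s = a"
      using z[OF Suc.prems] y[of r] Suc.prems len by (simp add: walk_append take)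
    then have 2: "walk T' 0 (y r @ ?b # z (Suc r)) s' = a'" using eq2 Suc.prems by simp
    have "walk T' (Suc r) (z (Suc r)) (T' r ?b (walk T' 0 (y r) s')) =
      walk T' (Suc r) (z (Suc r)) (walk T' 0 (y (Suc r)) s')"
      using 1 2 len by (simp add: walk_append)
    then have "T' r ?b (walk T' 0 (y r) s') = walk T' 0 (y (Suc r)) s'"
      using injD[OF inj_walk[of T', OF inj]] by blast
    then show ?case using Suc len by (simp add: take walk_append)
  qed
  then have "walk T' 0 x s' = walk T' 0 (y n) s'" using \<open>length x = n\<close> by force
  also have "\<dots> = a'"
  proof -
    \<comment> \<open>In the last layer the suffix is empty, so the answers are compared on
      \<open>y n\<close> itself.\<close>
    have "z n = []" using z[of n] by simp
    moreover have "walk T 0 (y n) s = a"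
      using y[of n] z[of n] \<open>z n = []\<close> by simp
    ultimately show ?thesis using eq1[of n] by simp
  qed
  finally show ?thesis .
qed

text \<open>An accepted input whose states are all heavy from both ends has witnesses in
  \<open>H\<close> at every layer, so \<open>T'\<close> accepts it. The other accepted inputs have
  density at most \<open>\<delta>\<close> for each end.\<close>

lemma card_accept_le:
  fixes T :: "nat \<Rightarrow> bool \<Rightarrow> 'v \<Rightarrow> 'v" and H :: "nat \<Rightarrow> bool list set"
  assumes bij: "\<And>i b. bij (T i b)" and inj': "\<And>i b. inj (T' i b)" and "0 \<le> \<delta>"
    and H: "\<And>k. H k \<subseteq> cube k"
    and hit: "\<And>k (g :: nat \<Rightarrow> bool \<Rightarrow> 'v \<Rightarrow> 'v) s u. \<lbrakk>\<And>k b. inj (g k b);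
      \<delta> * 2 ^ k \<le> real (card (reach g s k u))\<rbrakk>
      \<Longrightarrow> reach g s k u \<inter> H k \<noteq> {}"
    and eq: "\<And>x. x \<in> query_set H n \<Longrightarrow> walk T 0 x s = a \<longleftrightarrow> walk T' 0 x s' = a'"
  shows "real (card {x \<in> cube n. walk T 0 x s = a}) \<le>
    real (card {x \<in> cube n. walk T' 0 x s' = a'}) + 2 * \<delta> * 2 ^ n"
proof -
  define g where "g = (\<lambda>k. T (n - Suc k))"
  define h where "h = (\<lambda>k b. inv (T k b))"
  have ig: "\<And>k b. inj (g k b)" and ih: "\<And>k b. inj (h k b)"
    using bij by (auto simp: g_def h_def bij_is_inj bij_imp_bij_inv)
  \<comment> \<open>\<open>L g a s\<close> holds the accepted inputs visiting a state from which
    acceptance is unlikely, \<open>L h s a\<close> the reversals of those visiting a state that is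
    unlikely to be reached.\<close>
  define L where "L = (\<lambda>(g :: nat \<Rightarrow> bool \<Rightarrow> 'v \<Rightarrow> 'v) a s. {x \<in> reach g a n s. \<exists>y z v. x = y @ z \<and> run g z v = a \<and>
       real (card (reach g a (length z) v)) < \<delta> * 2 ^ length z})"
  have cL: "real (card (L g a s)) \<le> \<delta> * 2 ^ n" "real (card (L h s a)) \<le> \<delta> * 2 ^ n"
    unfolding L_def using \<open>0 \<le> \<delta>\<close>
    by (rule card_light_paths_le[of g, OF ig], rule card_light_paths_le[of h, OF ih])
  have "{x \<in> cube n. walk T 0 x s = a} \<subseteq>
    {x \<in> cube n. walk T' 0 x s' = a'} \<union> (L g a s \<union> rev ` L h s a)"
  proof
    fix x assume "x \<in> {x \<in> cube n. walk T 0 x s = a}"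
    then have x: "length x = n" "walk T 0 x s = a" by (auto simp: cube_def)
    show "x \<in> {x \<in> cube n. walk T' 0 x s' = a'} \<union> (L g a s \<union> rev ` L h s a)"
    proof (rule ccontr)
      assume neg: "\<not> ?thesis"
      have "x \<in> reach g a n s"
        using x walk_eq_run[of 0 x n T s] by (simp add: reach_def cube_def g_def)
      then have ng: "\<delta> * 2 ^ length z \<le> real (card (reach g a (length z) v))"
        if "x = y @ z" "run g z v = a" for y z v
        using neg that by (fastforce simp: L_def not_less)
      have "rev x \<in> reach h s n a"
        using x run_inv_rev_iff[of T, OF bij] by (simp add: reach_def cube_def h_def)
      moreover have "rev x \<notin> L h s a" using neg imageI[of "rev x" "L h s a" rev] by auto
      ultimately have nh: "\<delta> * 2 ^ length z \<le> real (card (reach h s (length z) v))"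
        if "rev x = y @ z" "run h z v = s" for y z v
        using that by (fastforce simp: L_def not_less)
      \<comment> \<open>Heaviness for \<open>h\<close> yields a reversed prefix in
        \<open>H r\<close>; below, heaviness for \<open>g\<close> yields a suffix in
        \<open>H (n - r)\<close>.\<close>
      have "\<exists>y. rev y \<in> H r \<and> walk T 0 y s = walk T 0 (take r x) s" if "r \<le> n" for r
      proof -
        let ?v = "walk T 0 (take r x) s"
        have "run h (rev (take r x)) ?v = s"
          unfolding h_def by (simp add: run_inv_rev_iff[of T, OF bij])
        moreover have "rev x = rev (drop r x) @ rev (take r x)"
          by (metis append_take_drop_id rev_append)
        ultimately have "\<delta> * 2 ^ r \<le> real (card (reach h s r ?v))"
          using nh[of _ "rev (take r x)" ?v] that x by simp
        then obtain y where y: "y \<in> reach h s r ?v" "y \<in> H r" using hit[of h, OF ih] by blast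
        then have "run h (rev (rev y)) ?v = s" by (simp add: reach_def)
        then have "walk T 0 (rev y) s = ?v" unfolding h_def by (simp only: run_inv_rev_iff[of T, OF bij])
        then show ?thesis using y by (intro exI[of _ "rev y"]) simp
      qed
      then obtain y where y: "\<And>r. r \<le> n \<Longrightarrow> rev (y r) \<in> H r \<and> walk T 0 (y r) s = walk T 0 (take r x) s"
        by metis
      have "\<exists>z. z \<in> H (n - r) \<and> walk T r z (walk T 0 (take r x) s) = a" if "r \<le> n" for r
      proof -
        let ?v = "walk T 0 (take r x) s"
        have "walk T r (drop r x) ?v = a"
          using x that walk_append[of T 0 "take r x" "drop r x" s] by simp
        then have "run g (drop r x) ?v = a"
          using x that walk_eq_run[of r "drop r x" n T ?v] by (simp add: g_def)
        then have "\<delta> * 2 ^ (n - r) \<le> real (card (reach g a (n - r) ?v))"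
          using ng[of "take r x" "drop r x" ?v] x by simp
        then obtain z where "z \<in> reach g a (n - r) ?v" "z \<in> H (n - r)" using hit[of g, OF ig] by blast
        then show ?thesis using that walk_eq_run[of r z n T ?v]
          by (auto simp: reach_def cube_def g_def)
      qed
      then obtain z where z: "\<And>r. r \<le> n \<Longrightarrow> z r \<in> H (n - r) \<and>
          walk T r (z r) (walk T 0 (take r x) s) = a"
        by metis
      have len: "length u = k" if "u \<in> H k" for u k using H that by (auto simp: cube_def)
      have q1: "y r @ z r \<in> query_set H n" if "r \<le> n" for r
      proof -
        have "y r @ z r \<in> (\<lambda>(y, z). rev y @ z) ` (H r \<times> H (n - r))"
          using y[OF that] z[OF that] by (intro image_eqI[of _ _ "(rev (y r), z r)"]) auto
        then show ?thesis using that unfolding query_set_def by blast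
      qed
      have q2: "y r @ b # z (Suc r) \<in> query_set H n" if "r < n" for r b
      proof -
        have "y r @ b # z (Suc r) \<in> (\<lambda>(y, b, z). rev y @ b # z) ` (H r \<times> UNIV \<times> H (n - Suc r))"
          using y[of r] z[of "Suc r"] that
          by (intro image_eqI[of _ _ "(rev (y r), b, z (Suc r))"]) auto
        then show ?thesis using that unfolding query_set_def by blast
      qed
      have "walk T' 0 x s' = a'"
      proof (rule accepts_of_witnesses[of T' x n y T s z a, OF inj' x(1)])
        show "length (y r) = r \<and> walk T 0 (y r) s = walk T 0 (take r x) s" if "r \<le> n" for r
          using y[OF that] len[of "rev (y r)"] by simp
        show "length (z r) = n - r \<and> walk T r (z r) (walk T 0 (take r x) s) = a" if "r \<le> n" for r
          using z[OF that] len by simp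
      qed (use eq q1 q2 in blast)+
      then show False using neg x by (auto simp: cube_def)
    qed
  qed
  moreover have "finite (L g a s)" "finite (L h s a)" by (auto simp: L_def)
  ultimately have "card {x \<in> cube n. walk T 0 x s = a} \<le>
    card ({x \<in> cube n. walk T' 0 x s' = a'} \<union> (L g a s \<union> rev ` L h s a))"
    by (intro card_mono) auto
  also have "\<dots> \<le> card {x \<in> cube n. walk T' 0 x s' = a'} + (card (L g a s) + card (rev ` L h s a))"
    by (intro order.trans[OF card_Un_le] add_left_mono card_Un_le)
  also have "card (rev ` L h s a) = card (L h s a)" by (simp add: card_image)
  finally show ?thesis using cL by linarith
qed

section \<open>Nonadaptive samplers\<close>

text \<open>Extending the transitions by the identity makes them permutations of all naturals, so
  programs of every width share one state type.\<close>

lemma perm_bp_single_accept_walk: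
  assumes "f \<in> perm_bp_single_accept n"
  shows "\<exists>T s a. (\<forall>i b. bij (T i b)) \<and> (\<forall>x\<in>cube n. f x \<longleftrightarrow> walk T 0 x s = (a :: nat))"
proof -
  obtain B a where B: "permutation_bp n B" "accept B = {a}" "computes n B f"
    using assms by (auto simp: perm_bp_single_accept_def card_1_singleton_iff)
  define V where "V = {1..width B}"
  \<comment> \<open>\<open>T i\<close> reads bit \<open>i\<close> counted from 0, hence the layer
    \<open>Suc i\<close> of \<open>transition\<close>.\<close>
  define T where "T = (\<lambda>i b v. if i < n \<and> v \<in> V then transition B (Suc i) v b else v)"
  have "bij (T i b)" for i b
  proof (cases "i < n")
    case True
    have "bij_betw (\<lambda>v. transition B (Suc i) v b) V V"
      using B(1) True by (auto simp: permutation_bp_def V_def)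
    then have "bij_betw (T i b) V V"
      using True by (subst bij_betw_cong[of V _ "\<lambda>v. transition B (Suc i) v b"]) (auto simp: T_def)
    moreover have "bij_betw (T i b) (- V) (- V)"
      by (subst bij_betw_cong[of "- V" _ id]) (auto simp: T_def)
    ultimately have "bij_betw (T i b) (V \<union> - V) (V \<union> - V)"
      by (intro bij_betw_combine) auto
    then show ?thesis by simp
  next
    case False
    then have "T i b = id" by (auto simp: T_def)
    then show ?thesis by simp
  qed
  moreover have "f x \<longleftrightarrow> walk T 0 x (start B) = a" if x: "x \<in> cube n" for x
  proof -
    have st: "state B x r = walk T 0 (take r x) (start B) \<and> state B x r \<in> V" if "r \<le> n" for r
      using that
    proof (induction r)
      case 0
      then show ?case using B(1) by (auto simp: permutation_bp_def ordered_bp_def V_def)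
    next
      case (Suc r)
      then have IH: "state B x r = walk T 0 (take r x) (start B)" "state B x r \<in> V" by auto
      have "r < length x" using Suc.prems x by (simp add: cube_def)
      then have "walk T 0 (take (Suc r) x) (start B) = T r (x ! r) (state B x r)"
        using IH by (simp add: take_Suc_conv_app_nth walk_append)
      moreover have "transition B (Suc r) (state B x r) (x ! r) \<in> V"
        using IH(2) Suc.prems B(1) by (auto simp: permutation_bp_def ordered_bp_def V_def)
      ultimately show ?case using IH Suc.prems by (simp add: T_def)
    qed
    have "f x \<longleftrightarrow> state B x n = a" using B x by (simp add: computes_def)
    then show ?thesis using st[of n] x by (simp add: cube_def)
  qed
  ultimately show ?thesis by (intro exI[of _ T] exI[of _ "start B"] exI[of _ a]) simp
qed

section \<open>Decision trees with a fixed list of queries\<close>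

primrec query_list :: "bool list list \<Rightarrow> (bool list \<Rightarrow> real) \<Rightarrow> oracle_alg" where
  "query_list [] out = Output (out [])"
| "query_list (q # qs) out = Query q (\<lambda>b. query_list qs (\<lambda>bs. out (b # bs)))"

lemma queries_query_list [simp]: "queries (query_list qs out) f = qs"
  by (induction qs arbitrary: out) auto

lemma samp_query_list [simp]: "samp (query_list qs out) f = out (map f qs)"
  by (induction qs arbitrary: out) auto

lemma query_complexity_query_list: "query_complexity F (query_list qs out) \<le> card (set qs)"
  by (cases "F = {}") (auto simp: query_complexity_def)

text \<open>Any member of \<open>F\<close> consistent with the answers can stand in for the oracle,
  and the oracle itself shows that one exists.\<close>

lemma sampler_of_determining_set:
  assumes Q: "Q \<subseteq> cube n"
    and det: "\<And>f f'. \<lbrakk>f \<in> F; f' \<in> F; \<And>x. x \<in> Q \<Longrightarrow> f x = f' x\<rbrakk> \<Longrightarrow>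
      \<bar>measure_pmf.prob (pmf_of_set (cube n)) {x. f' x} -
       measure_pmf.prob (pmf_of_set (cube n)) {x. f x}\<bar> \<le> \<epsilon>"
  shows "\<exists>S. deterministic_sampler n F \<epsilon> S \<and> nonadaptive S \<and> query_complexity F S \<le> card Q"
proof -
  obtain qs where qs: "set qs = Q" using finite_list[OF finite_subset[OF Q finite_cube]] by blast
  define out where "out = (\<lambda>bs. measure_pmf.prob (pmf_of_set (cube n))
    {x. (SOME f. f \<in> F \<and> map f qs = bs) x})"
  have "\<bar>out (map f qs) - measure_pmf.prob (pmf_of_set (cube n)) {x. f x}\<bar> \<le> \<epsilon>" if "f \<in> F" for f
  proof -
    define f' where "f' = (SOME f'. f' \<in> F \<and> map f' qs = map f qs)"
    have "f' \<in> F \<and> map f' qs = map f qs"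
      unfolding f'_def by (rule someI[of _ f]) (use that in simp)
    then have "\<bar>measure_pmf.prob (pmf_of_set (cube n)) {x. f' x} -
        measure_pmf.prob (pmf_of_set (cube n)) {x. f x}\<bar> \<le> \<epsilon>"
      using qs by (intro det[OF that]) auto
    then show ?thesis unfolding out_def f'_def .
  qed
  then have "deterministic_sampler n F \<epsilon> (query_list qs out)"
    using Q qs by (simp add: deterministic_sampler_def)
  moreover have "nonadaptive (query_list qs out)" by (simp add: nonadaptive_def)
  ultimately show ?thesis using query_complexity_query_list qs by blast
qed

lemma prob_cube:
  "measure_pmf.prob (pmf_of_set (cube n)) {x. f x} = real (card {x \<in> cube n. f x}) / 2 ^ n"
  by (simp add: measure_pmf_of_set Int_def)

lemma ex_sampler:
  fixes \<epsilon> :: real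
  assumes "0 < \<epsilon>" "\<epsilon> < 1"
  shows "\<exists>S. deterministic_sampler n (perm_bp_single_accept n) \<epsilon> S \<and> nonadaptive S \<and>
    real (query_complexity (perm_bp_single_accept n) S) \<le>
      (3 * real n + 1) * (640 * (real n + 1) / \<epsilon> ^ 3) ^ 2 \<and>
    query_complexity (perm_bp_single_accept n) S \<le> 2 ^ n"
proof -
  \<comment> \<open>Hitting needs density \<open>2 * \<theta>\<close>, and each of the two ends
    discards that much, so the total error is \<open>4 * \<theta> = \<epsilon>\<close>.\<close>
  define \<theta> where "\<theta> = \<epsilon> / 4"
  have \<theta>: "0 < \<theta>" "\<theta> \<le> 1" using assms by (auto simp: \<theta>_def)
  obtain H :: "nat \<Rightarrow> bool list set" where H: "\<And>k. H k \<subseteq> cube k"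
    and cardH: "\<And>k. real (card (H k)) \<le> 10 * (real k + 1) / \<theta> ^ 3"
    and hit: "\<And>k (g :: nat \<Rightarrow> bool \<Rightarrow> nat \<Rightarrow> nat) s u. \<lbrakk>\<And>k b. inj (g k b);
       2 * \<theta> * 2 ^ k \<le> real (card (reach g s k u))\<rbrakk> \<Longrightarrow> reach g s k u \<inter> H k \<noteq> {}"
    using hitting_set[OF \<theta>, where ?'v = nat] by metis
  define M where "M = nat \<lfloor>10 * (real n + 1) / \<theta> ^ 3\<rfloor>"
  have "card (H k) \<le> M" if "k \<le> n" for k
  proof -
    have "10 * (real k + 1) / \<theta> ^ 3 \<le> 10 * (real n + 1) / \<theta> ^ 3"
      using that \<theta> by (intro divide_right_mono) auto
    then show ?thesis using cardH[of k] unfolding M_def by linarith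
  qed
  moreover have "finite (H k)" for k using H finite_subset finite_cube by blast
  ultimately have "card (query_set H n) \<le> (3 * n + 1) * M ^ 2" by (intro card_query_set_le)
  then have "real (card (query_set H n)) \<le> real ((3 * n + 1) * M ^ 2)" by (rule of_nat_mono)
  also have "\<dots> = (3 * real n + 1) * real M ^ 2" by (simp add: algebra_simps)
  also have "\<dots> \<le> (3 * real n + 1) * (10 * (real n + 1) / \<theta> ^ 3) ^ 2"
    using \<theta> by (intro mult_left_mono power_mono) (auto simp: M_def)
  also have "10 * (real n + 1) / \<theta> ^ 3 = 640 * (real n + 1) / \<epsilon> ^ 3"
    by (simp add: \<theta>_def power_divide)
  finally have card: "real (card (query_set H n)) \<le>
    (3 * real n + 1) * (640 * (real n + 1) / \<epsilon> ^ 3) ^ 2" .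
  have sub: "query_set H n \<subseteq> cube n" using H by (rule query_set_subset_cube)
  \<comment> \<open>This bound serves for \<open>n = 0\<close>, where \<open>n / \<epsilon>\<close>
    vanishes while the other bound grows with \<open>1 / \<epsilon>\<close>.\<close>
  then have card2: "card (query_set H n) \<le> 2 ^ n" using card_mono[OF finite_cube] by fastforce
  have le: "real (card {x \<in> cube n. f x}) \<le> real (card {x \<in> cube n. f' x}) + \<epsilon> * 2 ^ n"
    if f: "f \<in> perm_bp_single_accept n" and f': "f' \<in> perm_bp_single_accept n"
      and eq: "\<And>x. x \<in> query_set H n \<Longrightarrow> f x = f' x" for f f'
  proof -
    obtain T s a where T: "\<And>i b. bij (T i b)" "\<And>x. x \<in> cube n \<Longrightarrow> f x \<longleftrightarrow> walk T 0 x s = (a :: nat)"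
      using perm_bp_single_accept_walk[OF f] by blast
    obtain T' s' a' where T': "\<And>i b. bij (T' i b)"
      "\<And>x. x \<in> cube n \<Longrightarrow> f' x \<longleftrightarrow> walk T' 0 x s' = (a' :: nat)"
      using perm_bp_single_accept_walk[OF f'] by blast
    have "real (card {x \<in> cube n. walk T 0 x s = a}) \<le>
      real (card {x \<in> cube n. walk T' 0 x s' = a'}) + 2 * (2 * \<theta>) * 2 ^ n"
    proof (rule card_accept_le[where H = H])
      show "walk T 0 x s = a \<longleftrightarrow> walk T' 0 x s' = a'" if "x \<in> query_set H n" for x
        using that eq T(2) T'(2) sub by blast
    qed (use T(1) T'(1) \<theta> H hit in \<open>auto simp: bij_is_inj\<close>)
    moreover have "{x \<in> cube n. f x} = {x \<in> cube n. walk T 0 x s = a}"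
      "{x \<in> cube n. f' x} = {x \<in> cube n. walk T' 0 x s' = a'}" using T(2) T'(2) by auto
    ultimately show ?thesis by (simp add: \<theta>_def)
  qed
  have "\<exists>S. deterministic_sampler n (perm_bp_single_accept n) \<epsilon> S \<and> nonadaptive S \<and>
      query_complexity (perm_bp_single_accept n) S \<le> card (query_set H n)"
  proof (rule sampler_of_determining_set[OF sub])
    fix f f' assume ff': "f \<in> perm_bp_single_accept n" "f' \<in> perm_bp_single_accept n"
      "\<And>x. x \<in> query_set H n \<Longrightarrow> f x = f' x"
    have "\<bar>real (card {x \<in> cube n. f' x}) - real (card {x \<in> cube n. f x})\<bar> \<le> \<epsilon> * 2 ^ n"
      using le[OF ff'] le[OF ff'(2,1)] ff'(3) by fastforce
    then show "\<bar>measure_pmf.prob (pmf_of_set (cube n)) {x. f' x} -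
       measure_pmf.prob (pmf_of_set (cube n)) {x. f x}\<bar> \<le> \<epsilon>"
      by (simp add: prob_cube diff_divide_distrib[symmetric] pos_divide_le_eq)
  qed
  then show ?thesis using card card2 by (meson of_nat_mono order.trans)
qed

theorem theorem1p6:
  "\<exists>p :: real poly. \<forall>n :: nat. \<forall>\<epsilon> :: real. 0 < \<epsilon> \<and> \<epsilon> < 1 \<longrightarrow>
     (\<exists>S. deterministic_sampler n (perm_bp_single_accept n) \<epsilon> S \<and>
          nonadaptive S \<and>
          real (query_complexity (perm_bp_single_accept n) S) \<le> poly p (real n / \<epsilon>))"
proof -
  \<comment> \<open>The monomial is \<open>4 * t * (1280 * t ^ 4) ^ 2\<close> at
    \<open>t = n / \<epsilon>\<close>; the summand 1 covers \<open>n = 0\<close>, where at most one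
    query is made.\<close>
  let ?p = "monom (4 * 1280 ^ 2) 9 + 1 :: real poly"
  have "\<exists>S. deterministic_sampler n (perm_bp_single_accept n) \<epsilon> S \<and> nonadaptive S \<and>
      real (query_complexity (perm_bp_single_accept n) S) \<le> poly ?p (real n / \<epsilon>)"
    if \<epsilon>: "0 < \<epsilon> \<and> \<epsilon> < 1" for n :: nat and \<epsilon> :: real
  proof -
    obtain S where S: "deterministic_sampler n (perm_bp_single_accept n) \<epsilon> S" "nonadaptive S"
      and q: "real (query_complexity (perm_bp_single_accept n) S) \<le>
        (3 * real n + 1) * (640 * (real n + 1) / \<epsilon> ^ 3) ^ 2"
      and q2: "query_complexity (perm_bp_single_accept n) S \<le> 2 ^ n"
      using ex_sampler \<epsilon> by blast
    have "real (query_complexity (perm_bp_single_accept n) S) \<le> poly ?p (real n / \<epsilon>)"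
    proof (cases "n = 0")
      case True
      then show ?thesis using q2 by (simp add: poly_monom)
    next
      case False
      define t where "t = real n / \<epsilon>"
      \<comment> \<open>Since \<open>n \<ge> 1\<close> and \<open>\<epsilon> < 1\<close>, the
        quotient \<open>t\<close> dominates both \<open>n\<close> and
        \<open>1 / \<epsilon>\<close>.\<close>
      have n: "1 \<le> real n" "real n \<le> t" "1 / \<epsilon> \<le> t"
        using False \<epsilon> by (auto simp: t_def field_simps)
      have "640 * (real n + 1) / \<epsilon> ^ 3 = 640 * (real n + 1) * (1 / \<epsilon>) ^ 3"
        by (simp add: power_divide)
      also have "\<dots> \<le> 640 * (2 * t) * t ^ 3"
        using n \<epsilon> by (intro mult_mono power_mono) auto
      also have "\<dots> = 1280 * t ^ 4" by (simp add: power_numeral_reduce)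
      finally have "(640 * (real n + 1) / \<epsilon> ^ 3) ^ 2 \<le> (1280 * t ^ 4) ^ 2"
        using \<epsilon> by (intro power_mono) auto
      then have "(3 * real n + 1) * (640 * (real n + 1) / \<epsilon> ^ 3) ^ 2 \<le> (4 * t) * (1280 * t ^ 4) ^ 2"
        using n by (intro mult_mono) auto
      also have "\<dots> = 4 * 1280 ^ 2 * t ^ 9" by (simp add: power_numeral_reduce)
      finally show ?thesis using q by (simp add: poly_monom t_def)
    qed
    with S show ?thesis by blast
  qed
  then show ?thesis by blast
qed

end
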